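(* Consider the delayed system $\dot x(t)=f(x(t),u(t-\tau))$ with $\tau>0$, the predicted state $x_p(t)=x(t+\tau)$, its estimate $\hat x_p(t)$, and the integral controller $\dot u(t)=\phi(\hat x_p(t),u(t))+q(\hat x_p(t),u(t))$, $t\ge 0$, as in the context. For each barrier $h_i$ under consideration (a single barrier $h$, or the two barriers $h_e,h_u$) let $\mathcal S_i$, $\mathcal S_{i,\delta}$, $a_i,b_i,r_i$ be as in the context. Suppose the following assumptions hold for each barrier $h_i$ under consideration: (A1) $\big[\tfrac{\partial h_i}{\partial x}(x,u),\tfrac{\partial h_i}{\partial u}(x,u)\big]\ne 0$ for all $(x,u)\in\mathbb{R}^n\times\mathbb{R}^m$ with $h_i(x,u)\le 0$; (A2) there is $\delta\ge 0$ such that the disturbance $d(t):=\phi(\hat x_p(t),u(t))+q(\hat x_p(t),u(t))-\phi(x_p(t),u(t))-q(x_p(t),u(t))$ satisfies $\|d(t)\|\le\delta$ for all $t\ge 0$; (A3) $(x(\vartheta),u(\vartheta-\tau))\in\mathcal S_i$ for all $\vartheta\in[0,\tau]$. (1) Single barrier $h$ (index $i$ dropped). Suppose that for all $(x,u)\in\mathbb{R}^n\times\mathbb{R}^m$, $b(x,u)=0\implies a(x,u)\le 0$. Then any locally Lipschitz $q:\mathbb{R}^n\times\mathbb{R}^m\to\mathbb{R}^m$ such that $v=q(x_p,u)$ satisfies $$b(x_p,u)^\top v\ \ge\ a(x_p,u)+r(x_p,u)\quad\text{for all }(x_p,u)\in\mathcal S_\delta$$ renders $\mathcal S_\delta$ forward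 invariant for the closed-loop system. Further, if $\delta\le\mu(0)$, then $\mathcal S$ is also forward invariant, i.e. $(x(0),u(-\tau))\in\mathcal S\implies (x(t),u(t-\tau))\in\mathcal S$ for all $t\ge 0$. (2) Two barriers $h_e,h_u$. Suppose that for all $(x,u)\in\mathbb{R}^n\times\mathbb{R}^m$, with all quantities evaluated at $(x,u)$: $b_e=0\implies a_e\le0$; $b_u=0\implies a_u\le 0$; and $\|b_e\|\|b_u\|+b_e^\top b_u=0\implies (a_e+r_e)\|b_u\|+(a_u+r_u)\|b_e\|\le 0$. Then any locally Lipschitz $q:\mathbb{R}^n\times\mathbb{R}^m\to\mathbb{R}^m$ such that $v=q(x_p,u)$ satisfies $$b_i(x_p,u)^\top v\ \ge\ a_i(x_p,u)+r_i(x_p,u),\quad \forall i\in\{e,u\},\quad\text{for all }(x_p,u)\in\mathcal S_{e,\delta}\cap\mathcal S_{u,\delta}$$ renders $\mathcal S_{e,\delta}\cap\mathcal S_{u,\delta}$ forward invariant for the closed-loop system. Further, if $\delta\le\min\{\mu_e(0),\mu_u(0)\}$, then $\mathcal S_e\cap\mathcal S_u$ is also forward invariant, i.e. $(x(0),u(-\tau))\in\mathcal S_e\cap\mathcal S_u\implies (x(t),u(t-\tau))\in\mathcal S_e\cap\mathcal S_u$ for all $t\ge 0$.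
   Context: $\|\cdot\|$ is the Euclidean norm; gradients $\partial h/\partial x$, $\partial h/\partial u$ are row vectors. An extended class-$\mathcal K$ function ($\alpha\in\mathcal{K}^{\rm e}$) is a continuous strictly increasing function $\alpha:(-b,a)\to\mathbb{R}$, $a,b>0$, with $\alpha(0)=0$. Domains and ranges of the extended class-$\mathcal K$ functions are assumed such that all expressions below involving $\alpha_i$ and $\alpha_i^{-1}$ are defined. System. $f:\mathbb{R}^n\times\mathbb{R}^m\to\mathbb{R}^n$ and $\phi:\mathbb{R}^n\times\mathbb{R}^m\to\mathbb{R}^m$ are continuously differentiable and $\tau>0$ is a constant delay. The plant is $\dot x(t)=f(x(t),u(t-\tau))$; it is assumed that, given $x(0)$ and a continuous input history, it has a unique solution for all $t\ge 0$. With the input history $u_t(\vartheta):=u(t+\vartheta)$, $\vartheta\in[-\tau,0)$, the predicted state is $x_p(t):=x(t+\tau)=\Psi(\tau,x(t),u_t)$, where $\Psi(\theta,x,u_t)=x+\int_0^\theta f(\Psi(s,x,u_t),u_t(s-\tau))\,ds$. Consequently $\dot x_p(t)=f(x_p(t),u(t))$. The controller only has an estimate $\hat x_p(t)\in\mathbb{R}^n$ of $x_p(t)$ (for example, one computed with an incorrect delay value), and the input is generated for $t\ge 0$ by $\dot u(t)=\phi(\hat x_p(t),u(t))+q(\hat x_p(t),u(t))$. Equivalently, $\dot u=\phi(x_p,u)+q(x_p,u)+d$ with $d$ as in (A2). Closed-loop solutions $(x(t),u(t))$ are taken to exist for all $t\ge0$. Barriers and sets. Each $h_i:\mathbb{R}^n\times\mathbb{R}^m\to\mathbb{R}$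 is continuously differentiable. In the single-barrier case there is one general such function $h$ (with $\alpha,\mu,\sigma,a,b,r,\mathcal S,\mathcal S_\delta$ written without index). In the two-barrier case, $h_u(x,u)=h_u(u)$ depends only on $u$, and $h_e(x,u):=\frac{\partial h_x}{\partial x}(x)f(x,u)+\alpha_x(h_x(x))$ for a continuously differentiable $h_x:\mathbb{R}^n\to\mathbb{R}$ and $\alpha_x\in\mathcal K^{\rm e}$. With $\alpha_i\in\mathcal K^{\rm e}$ define $$b_i(x,u):=\Big(\frac{\partial h_i}{\partial u}(x,u)\Big)^\top,\qquad a_i(x,u):=-\frac{\partial h_i}{\partial x}(x,u)f(x,u)-\frac{\partial h_i}{\partial u}(x,u)\phi(x,u)-\alpha_i(h_i(x,u)),$$ $$r_i(x,u):=\mu_i(h_i(x,u))\|b_i(x,u)\|+\sigma_i(h_i(x,u))\|b_i(x,u)\|^2,$$ where $\mu_i,\sigma_i:\mathbb{R}\to\mathbb{R}_{>0}$ are continuously differentiable and monotonically decreasing. The safe set and inflated set are $$\mathcal S_i:=\{(x,u)\in\mathbb{R}^n\times\mathbb{R}^m: h_i(x,u)\ge 0\},\qquad \mathcal S_{i,\delta}:=\{(x,u)\in\mathbb{R}^n\times\mathbb{R}^m: h_{i,\delta}(x,u)\ge0\},$$ $$h_{i,\delta}(x,u):=h_i(x,u)-\alpha_i^{-1}\!\left(-\frac{(\mu_i(0)-\delta)^2}{4\,\sigma_i(h_i(x,u))}\right).$$ Forward invariance of a set $\mathcal A\subseteq\mathbb{R}^n\times\mathbb{R}^m$ for the closed-loop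 delayed system means: $(x(0),u(-\tau))\in\mathcal A\implies (x(t),u(t-\tau))\in\mathcal A$ for all $t\ge 0$, along closed-loop solutions satisfying the stated assumptions. *)

theory Defs
  imports "HOL-Analysis.Analysis"
begin

text \<open>The pair \<open>(x, u)\<close> of a state and an input is an element of
  \<open>(real^'n) \<times> (real^'m)\<close>; all maps of \<open>(x, u)\<close> are written uncurried.\<close>

definition C1 :: "('a::real_normed_vector \<Rightarrow> 'b::real_normed_vector) \<Rightarrow> bool" where
  "C1 g \<longleftrightarrow> (\<exists>g' :: 'a \<Rightarrow> 'a \<Rightarrow>\<^sub>L 'b.
      (\<forall>z. (g has_derivative blinfun_apply (g' z)) (at z)) \<and> continuous_on UNIV g')"

definition locally_lipschitz :: "('a::metric_space \<Rightarrow> 'b::metric_space) \<Rightarrow> bool" where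
  "locally_lipschitz g \<longleftrightarrow> (\<forall>z. \<exists>e>0. \<exists>L. L-lipschitz_on (ball z e) g)"

text \<open>The domain \<open>D = (-b, a)\<close> of an extended class-K function is carried along as a set. The
  end points are extended reals, so that functions on all of the reals are included.\<close>

definition ext_class_K :: "real set \<Rightarrow> (real \<Rightarrow> real) \<Rightarrow> bool" where
  "ext_class_K D \<alpha> \<longleftrightarrow>
     (\<exists>a b :: ereal. 0 < a \<and> 0 < b \<and> D = {s. - b < ereal s \<and> ereal s < a}) \<and>
     continuous_on D \<alpha> \<and> strict_mono_on D \<alpha> \<and> \<alpha> 0 = 0"

text \<open>Vector of the partial derivatives; a row vector times a column vector is rendered as the
  inner product with the gradient.\<close>

definition gradient :: "(real^'k \<Rightarrow> real) \<Rightarrow> real^'k \<Rightarrow> real^'k" where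
  "gradient g y = (\<chi> i. frechet_derivative g (at y) (axis i 1))"

definition grad_x :: "((real^'n) \<times> (real^'m) \<Rightarrow> real) \<Rightarrow> (real^'n) \<times> (real^'m) \<Rightarrow> real^'n" where
  "grad_x h z = gradient (\<lambda>x. h (x, snd z)) (fst z)"

definition grad_u :: "((real^'n) \<times> (real^'m) \<Rightarrow> real) \<Rightarrow> (real^'n) \<times> (real^'m) \<Rightarrow> real^'m" where
  "grad_u h z = gradient (\<lambda>u. h (fst z, u)) (snd z)"


subsection \<open>Barriers and sets\<close>

definition barrier_b :: "((real^'n) \<times> (real^'m) \<Rightarrow> real) \<Rightarrow> (real^'n) \<times> (real^'m) \<Rightarrow> real^'m" where
  "barrier_b h z = grad_u h z"

definition barrier_a ::
  "((real^'n) \<times> (real^'m) \<Rightarrow> real^'n) \<Rightarrow> ((real^'n) \<times> (real^'m) \<Rightarrow> real^'m) \<Rightarrow>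
   (real \<Rightarrow> real) \<Rightarrow> ((real^'n) \<times> (real^'m) \<Rightarrow> real) \<Rightarrow> (real^'n) \<times> (real^'m) \<Rightarrow> real" where
  "barrier_a f \<phi> \<alpha> h z = - (grad_x h z \<bullet> f z) - (grad_u h z \<bullet> \<phi> z) - \<alpha> (h z)"

definition barrier_r ::
  "(real \<Rightarrow> real) \<Rightarrow> (real \<Rightarrow> real) \<Rightarrow> ((real^'n) \<times> (real^'m) \<Rightarrow> real) \<Rightarrow>
   (real^'n) \<times> (real^'m) \<Rightarrow> real" where
  "barrier_r \<mu> \<sigma> h z = \<mu> (h z) * norm (barrier_b h z) + \<sigma> (h z) * (norm (barrier_b h z))\<^sup>2"

definition safe_set :: "((real^'n) \<times> (real^'m) \<Rightarrow> real) \<Rightarrow> ((real^'n) \<times> (real^'m)) set" where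
  "safe_set h = {z. h z \<ge> 0}"

definition inflated_barrier ::
  "real set \<Rightarrow> (real \<Rightarrow> real) \<Rightarrow> (real \<Rightarrow> real) \<Rightarrow> (real \<Rightarrow> real) \<Rightarrow> real \<Rightarrow>
   ((real^'n) \<times> (real^'m) \<Rightarrow> real) \<Rightarrow> (real^'n) \<times> (real^'m) \<Rightarrow> real" where
  "inflated_barrier D \<alpha> \<mu> \<sigma> \<delta> h z =
     h z - inv_into D \<alpha> (- ((\<mu> 0 - \<delta>)\<^sup>2 / (4 * \<sigma> (h z))))"

definition inflated_set ::
  "real set \<Rightarrow> (real \<Rightarrow> real) \<Rightarrow> (real \<Rightarrow> real) \<Rightarrow> (real \<Rightarrow> real) \<Rightarrow> real \<Rightarrow>
   ((real^'n) \<times> (real^'m) \<Rightarrow> real) \<Rightarrow> ((real^'n) \<times> (real^'m)) set" where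
  "inflated_set D \<alpha> \<mu> \<sigma> \<delta> h = {z. inflated_barrier D \<alpha> \<mu> \<sigma> \<delta> h z \<ge> 0}"

text \<open>Regularity of the data of one barrier. The conditions on \<open>h z \<in> D\<close> and on the image
  \<open>\<alpha> ` D\<close> say that the expressions \<open>\<alpha> (h z)\<close> and the inverse value in
  \<open>inflated_barrier\<close> are defined.\<close>

definition barrier_data ::
  "real set \<Rightarrow> (real \<Rightarrow> real) \<Rightarrow> (real \<Rightarrow> real) \<Rightarrow> (real \<Rightarrow> real) \<Rightarrow> real \<Rightarrow>
   ((real^'n) \<times> (real^'m) \<Rightarrow> real) \<Rightarrow> bool" where
  "barrier_data D \<alpha> \<mu> \<sigma> \<delta> h \<longleftrightarrow>
     C1 h \<and> ext_class_K D \<alpha> \<and>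
     C1 \<mu> \<and> antimono \<mu> \<and> (\<forall>s. \<mu> s > 0) \<and>
     C1 \<sigma> \<and> antimono \<sigma> \<and> (\<forall>s. \<sigma> s > 0) \<and>
     (\<forall>z. h z \<in> D) \<and>
     (\<forall>z. - ((\<mu> 0 - \<delta>)\<^sup>2 / (4 * \<sigma> (h z))) \<in> \<alpha> ` D)"

definition regular_barrier :: "((real^'n) \<times> (real^'m) \<Rightarrow> real) \<Rightarrow> bool" where
  "regular_barrier h \<longleftrightarrow> (\<forall>z. h z \<le> 0 \<longrightarrow> (grad_x h z, grad_u h z) \<noteq> 0)"

text \<open>The barrier \<open>h\<^sub>e\<close> obtained from a state constraint \<open>h\<^sub>x \<ge> 0\<close>.\<close>

definition extended_barrier ::
  "((real^'n) \<times> (real^'m) \<Rightarrow> real^'n) \<Rightarrow> (real \<Rightarrow> real) \<Rightarrow> (real^'n \<Rightarrow> real) \<Rightarrow>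
   (real^'n) \<times> (real^'m) \<Rightarrow> real" where
  "extended_barrier f \<alpha>x hx z = gradient hx (fst z) \<bullet> f z + \<alpha>x (hx (fst z))"


subsection \<open>The delayed closed loop\<close>

text \<open>The input history lives on \<open>[-\<tau>, 0)\<close> and \<open>u 0\<close> is the initial value of the controller, so
  \<open>u\<close> may jump at \<open>0\<close>. At the corresponding time \<open>\<tau>\<close> the state is only required to be
  continuous, with the equation holding as a right derivative. If \<open>u\<close> is continuous at \<open>0\<close>, this
  is the ordinary notion of a solution on \<open>[0, \<infinity>)\<close>.\<close>

definition plant_solution ::
  "((real^'n) \<times> (real^'m) \<Rightarrow> real^'n) \<Rightarrow> real \<Rightarrow> (real \<Rightarrow> real^'m) \<Rightarrow> (real \<Rightarrow> real^'n) \<Rightarrow> bool" where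
  "plant_solution f \<tau> u x \<longleftrightarrow>
     continuous_on {0..} x \<and>
     (\<forall>t\<in>{0..<\<tau>}. (x has_vector_derivative f (x t, u (t - \<tau>))) (at t within {0..<\<tau>})) \<and>
     (\<forall>t\<in>{\<tau>..}. (x has_vector_derivative f (x t, u (t - \<tau>))) (at t within {\<tau>..}))"

definition plant_well_posed ::
  "((real^'n) \<times> (real^'m) \<Rightarrow> real^'n) \<Rightarrow> real \<Rightarrow> bool" where
  "plant_well_posed f \<tau> \<longleftrightarrow>
     (\<forall>x0 u. continuous_on {-\<tau>..} u \<longrightarrow>
        (\<exists>x. plant_solution f \<tau> u x \<and> x 0 = x0 \<and>
             (\<forall>y. plant_solution f \<tau> u y \<and> y 0 = x0 \<longrightarrow> (\<forall>t\<ge>0. y t = x t))))"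

definition predicted_state :: "real \<Rightarrow> (real \<Rightarrow> real^'n) \<Rightarrow> real \<Rightarrow> real^'n" where
  "predicted_state \<tau> x t = x (t + \<tau>)"

text \<open>The estimate \<open>xhat\<close> of the predicted state is an arbitrary signal.\<close>

definition closed_loop_solution ::
  "((real^'n) \<times> (real^'m) \<Rightarrow> real^'n) \<Rightarrow> ((real^'n) \<times> (real^'m) \<Rightarrow> real^'m) \<Rightarrow>
   ((real^'n) \<times> (real^'m) \<Rightarrow> real^'m) \<Rightarrow> real \<Rightarrow>
   (real \<Rightarrow> real^'n) \<Rightarrow> (real \<Rightarrow> real^'m) \<Rightarrow> (real \<Rightarrow> real^'n) \<Rightarrow> bool" where
  "closed_loop_solution f \<phi> q \<tau> x u xhat \<longleftrightarrow>
     continuous_on {-\<tau>..<0} u \<and>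
     plant_solution f \<tau> u x \<and>
     (\<forall>t\<in>{0..}. (u has_vector_derivative (\<phi> (xhat t, u t) + q (xhat t, u t))) (at t within {0..}))"

definition disturbance ::
  "((real^'n) \<times> (real^'m) \<Rightarrow> real^'m) \<Rightarrow> ((real^'n) \<times> (real^'m) \<Rightarrow> real^'m) \<Rightarrow> real \<Rightarrow>
   (real \<Rightarrow> real^'n) \<Rightarrow> (real \<Rightarrow> real^'m) \<Rightarrow> (real \<Rightarrow> real^'n) \<Rightarrow> real \<Rightarrow> real^'m" where
  "disturbance \<phi> q \<tau> x u xhat t =
     \<phi> (xhat t, u t) + q (xhat t, u t)
       - \<phi> (predicted_state \<tau> x t, u t) - q (predicted_state \<tau> x t, u t)"

text \<open>Closed-loop trajectories along which the disturbance is bounded by \<open>\<delta>\<close> and every barrier in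
  \<open>H\<close> is nonnegative on the initial interval, where the controller has no influence yet.\<close>

definition admissible_run ::
  "((real^'n) \<times> (real^'m) \<Rightarrow> real^'n) \<Rightarrow> ((real^'n) \<times> (real^'m) \<Rightarrow> real^'m) \<Rightarrow>
   ((real^'n) \<times> (real^'m) \<Rightarrow> real^'m) \<Rightarrow> real \<Rightarrow> real \<Rightarrow> ((real^'n) \<times> (real^'m) \<Rightarrow> real) set \<Rightarrow>
   (real \<Rightarrow> real^'n) \<Rightarrow> (real \<Rightarrow> real^'m) \<Rightarrow> bool" where
  "admissible_run f \<phi> q \<tau> \<delta> H x u \<longleftrightarrow>
     (\<exists>xhat. closed_loop_solution f \<phi> q \<tau> x u xhat \<and>
             (\<forall>t\<ge>0. norm (disturbance \<phi> q \<tau> x u xhat t) \<le> \<delta>)) \<and>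
     (\<forall>h\<in>H. \<forall>s\<in>{0..\<tau>}. (x s, u (s - \<tau>)) \<in> safe_set h)"

definition forward_invariant ::
  "real \<Rightarrow> ((real \<Rightarrow> real^'n) \<Rightarrow> (real \<Rightarrow> real^'m) \<Rightarrow> bool) \<Rightarrow>
   ((real^'n) \<times> (real^'m)) set \<Rightarrow> bool" where
  "forward_invariant \<tau> run A \<longleftrightarrow>
     (\<forall>x u. run x u \<longrightarrow> (x 0, u (-\<tau>)) \<in> A \<longrightarrow> (\<forall>t\<ge>0. (x t, u (t - \<tau>)) \<in> A))"

end

theory Submission
  imports Defs
begin

text \<open>The pair \<open>z t = (x (t + \<tau>), u t)\<close> of predicted state and input solves the undelayed equation
  \<open>z' = (f z, \<phi> z + q z + d t)\<close>, whose right-hand side is locally Lipschitz up to a disturbance of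
  norm at most \<open>\<delta>\<close>. Since \<open>\<alpha>\<close> and \<open>1 / \<sigma>\<close> are increasing, both kinds of sets have the form
  \<open>\<alpha> (h z) + c / (4 * \<sigma> (h z)) \<ge> 0\<close>, with \<open>c = 0\<close> for the safe set and \<open>c = (\<mu> 0 - \<delta>)\<^sup>2\<close> for the
  inflated one, and every constraint of this form is a superlevel condition on the smooth function
  \<open>h\<close>. On its boundary \<open>h \<le> 0\<close>, and completing the square in \<open>norm b\<close> makes the derivative of \<open>h\<close>
  nonnegative along all admissible velocities.

  This weak inequality suffices because of the Lipschitz property: if \<open>p\<close> is a point of the set \<open>K\<close>
  nearest to \<open>z\<close>, then \<open>z - p\<close> has nonpositive inner product with the velocities at \<open>p\<close>, so the
  squared distance to \<open>K\<close> grows at most exponentially and stays 0. The normality of \<open>z - p\<close>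
  requires a direction along which all active barriers strictly increase. For two barriers with
  opposite gradients there is none, but then the drift terms cancel in the compatibility
  condition, which would force the positive robustness terms \<open>r\<close> to be nonpositive.\<close>

subsection \<open>Strong invariance under a Lipschitz vector field\<close>

lemma continuous_induction:
  fixes a b :: real
  assumes ab: "a \<le> b" and base: "P a" and cl: "closed {t \<in> {a..b}. P t}"
    and step: "\<And>t. a \<le> t \<Longrightarrow> t < b \<Longrightarrow> P t \<Longrightarrow> eventually P (at_right t)"
  shows "P b"
proof (rule ccontr)
  assume nb: "\<not> P b"
  define N where "N = {t \<in> {a..b}. \<not> P t}"
  define c where "c = Inf N"
  have bN: "b \<in> N" using nb ab by (simp add: N_def)
  have bdd: "bdd_below N" by (rule bdd_belowI[of _ a]) (simp add: N_def)
  have cb: "c \<le> b" unfolding c_def by (rule cInf_lower[OF bN bdd])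
  have ac: "a \<le> c" unfolding c_def by (rule cInf_greatest) (use bN in \<open>auto simp: N_def\<close>)
  have below: "P s" if "a \<le> s" "s < c" for s
    using cInf_lower[OF _ bdd, of s] that cb by (force simp: N_def c_def)
  have Pc: "P c"
  proof (cases "a = c")
    case False
    then have "closure {a..<c} \<subseteq> {t \<in> {a..b}. P t}"
      by (intro closure_minimal cl) (use below cb in auto)
    with False ac show ?thesis by auto
  qed (use base in simp)
  then have "c < b" using cb nb by (cases "c = b") auto
  from step[OF ac this Pc] obtain d where d: "c < d" "\<And>y. c < y \<Longrightarrow> y < d \<Longrightarrow> P y"
    by (auto simp: eventually_at_right_field)
  have "d \<le> Inf N"
  proof (rule cInf_greatest)
    fix s assume "s \<in> N"
    then have "\<not> P s" "a \<le> s" by (auto simp: N_def)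
    with below d Pc show "d \<le> s" by (metis not_le not_less_iff_gr_or_eq)
  qed (use bN in auto)
  with d(1) show False by (simp add: c_def)
qed

lemma strong_invariance:
  fixes z :: "real \<Rightarrow> 'a::euclidean_space"
  assumes lip: "locally_lipschitz F" and K: "closed K"
    and der: "\<And>t. t \<ge> 0 \<Longrightarrow> (z has_vector_derivative F (z t) + d t) (at t within {0..})"
    and init: "z 0 \<in> K"
    and normal: "\<And>y p t. p \<in> K \<Longrightarrow> (\<And>k. k \<in> K \<Longrightarrow> dist y p \<le> dist y k) \<Longrightarrow> t \<ge> 0 \<Longrightarrow>
                   (y - p) \<bullet> (F p + d t) \<le> 0"
    and T: "T \<ge> 0"
  shows "z T \<in> K"
proof (rule continuous_induction[where P = "\<lambda>t. z t \<in> K", OF T init])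
  have cont: "continuous_on {0..} z"
    using der by (auto simp: continuous_on_eq_continuous_within intro: has_vector_derivative_continuous)
  then have contI: "continuous_on S z" if "S \<subseteq> {0..}" for S
    using that by (rule continuous_on_subset)
  show "closed {t \<in> {0..T}. z t \<in> K}"
    using continuous_closed_preimage[OF contI closed_atLeastAtMost K, of 0 T]
    by (simp add: vimage_def Int_def)
  fix t0 :: real assume t0: "0 \<le> t0" "z t0 \<in> K"
  obtain r L where r: "r > 0" and L: "L-lipschitz_on (ball (z t0) r) F"
    using lip unfolding locally_lipschitz_def by blast
  have L0: "0 \<le> L" using L by (rule lipschitz_on_nonneg)
  obtain e where e: "e > 0" and ze: "\<And>s. s \<ge> 0 \<Longrightarrow> dist s t0 < e \<Longrightarrow> dist (z s) (z t0) < r / 2"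
    using cont t0 r unfolding continuous_on_iff by (metis atLeast_iff half_gt_zero)
  have "z s1 \<in> K" if s1: "t0 < s1" "s1 < t0 + e" for s1
  proof -
    have small: "(infdist (z s1) K)\<^sup>2 - \<eta> * exp ((2 * L + 1) * (s1 - t0)) \<le> 0" if \<eta>: "\<eta> > 0" for \<eta>
    proof -
      define w where "w s = (infdist (z s) K)\<^sup>2 - \<eta> * exp ((2 * L + 1) * (s - t0))" for s
      have cw: "continuous_on {0..} w"
        unfolding w_def by (intro continuous_intros cont)
      have "w s1 \<le> 0"
      proof (rule continuous_induction[where P = "\<lambda>s. w s \<le> 0" and a = t0])
        show "w t0 \<le> 0" using t0 \<eta> by (simp add: w_def)
        show "closed {t \<in> {t0..s1}. w t \<le> 0}"
          using continuous_closed_preimage[OF continuous_on_subset[OF cw] closed_atLeastAtMost, of t0 s1 "{..0}"]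
            t0 by (simp add: vimage_def Int_def)
        fix t assume t: "t0 \<le> t" "t < s1" "w t \<le> 0"
        have sub: "{t<..} \<subseteq> {0..}" using t t0 by auto
        consider "w t < 0" | "w t = 0" using t by linarith
        then show "\<forall>\<^sub>F s in at_right t. w s \<le> 0"
        proof cases
          case 1
          have "(w \<longlongrightarrow> w t) (at t within {0..})"
            using cw t t0 by (simp add: continuous_on_def)
          then have "(w \<longlongrightarrow> w t) (at_right t)" by (rule tendsto_within_subset[OF _ sub])
          from order_tendstoD(2)[OF this 1] show ?thesis
            by (rule eventually_mono) simp
        next
          case 2
          obtain p where p: "p \<in> K" "infdist (z t) K = dist (z t) p"
            using infdist_attains_inf[OF K] t0 by blast
          have near: "dist (z t) p \<le> dist (z t) k" if "k \<in> K" for k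
            using infdist_le[OF that, of "z t"] p by simp
          have zt: "dist (z t) (z t0) < r / 2"
            using ze[of t] t t0 s1 by (simp add: dist_real_def)
          have "dist (z t0) p \<le> dist (z t0) (z t) + dist (z t) p" by (rule dist_triangle)
          also have "\<dots> < r" using near[OF t0(2)] zt by (simp add: dist_commute)
          finally have "dist (F (z t)) (F p) \<le> L * dist (z t) p"
            using zt r by (intro lipschitz_onD[OF L]) (auto simp: dist_commute)
          then have FL: "norm (F (z t) - F p) \<le> L * norm (z t - p)" by (simp add: dist_norm)
          have "(z t - p) \<bullet> (F (z t) + d t) =
                  (z t - p) \<bullet> (F p + d t) + (z t - p) \<bullet> (F (z t) - F p)"
            by (simp add: inner_diff_right inner_add_right)
          also have "\<dots> \<le> 0 + norm (z t - p) * (L * norm (z t - p))"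
            using normal[OF p(1) near, of t] t t0
              order_trans[OF norm_cauchy_schwarz mult_left_mono[OF FL norm_ge_zero]]
            by (intro add_mono) auto
          also have "\<dots> = L * (norm (z t - p))\<^sup>2" by (simp add: power2_eq_square)
          finally have inn: "(z t - p) \<bullet> (F (z t) + d t) \<le> L * (norm (z t - p))\<^sup>2" .
          \<comment> \<open>\<open>w\<close> need not be differentiable; freezing the nearest point \<open>p\<close> gives the differentiable
            majorant \<open>k\<close>, which touches \<open>w\<close> at \<open>t\<close>.\<close>
          define k where "k s = (z s - p) \<bullet> (z s - p) - \<eta> * exp ((2 * L + 1) * (s - t0))" for s
          have kw: "w s \<le> k s" for s
            using infdist_le[OF p(1), of "z s"]
            by (auto simp: w_def k_def dist_norm power2_norm_eq_inner[symmetric] infdist_nonneg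
                intro!: power_mono)
          have kt: "k t = 0"
            using 2 p(2) by (simp add: w_def k_def dist_norm power2_norm_eq_inner)
          have ex: "(norm (z t - p))\<^sup>2 = \<eta> * exp ((2 * L + 1) * (t - t0))"
            using kt by (simp add: k_def power2_norm_eq_inner)
          have dz: "(z has_derivative (\<lambda>s. s *\<^sub>R (F (z t) + d t))) (at t within {0..})"
            using der[of t] t t0 by (simp add: has_vector_derivative_def)
          have "(k has_derivative (*) (2 * ((z t - p) \<bullet> (F (z t) + d t)) -
                   (2 * L + 1) * (\<eta> * exp ((2 * L + 1) * (t - t0))))) (at t within {0..})"
            unfolding k_def
            by (rule derivative_eq_intros dz refl)+
              (auto simp: fun_eq_iff inner_commute algebra_simps)
          then have "(k has_real_derivative (2 * ((z t - p) \<bullet> (F (z t) + d t)) -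
                   (2 * L + 1) * (\<eta> * exp ((2 * L + 1) * (t - t0))))) (at t within {0..})"
            by (simp only: has_field_derivative_def)
          moreover have "2 * ((z t - p) \<bullet> (F (z t) + d t)) -
                   (2 * L + 1) * (\<eta> * exp ((2 * L + 1) * (t - t0))) < 0"
          proof -
            have "0 < \<eta> * exp ((2 * L + 1) * (t - t0))" using \<eta> by simp
            then show ?thesis using inn unfolding ex by (simp add: algebra_simps)
          qed
          ultimately obtain \<epsilon> where \<epsilon>: "\<epsilon> > 0"
            "\<And>s. s > 0 \<Longrightarrow> t + s \<in> {0..} \<Longrightarrow> s < \<epsilon> \<Longrightarrow> k (t + s) < k t"
            using has_real_derivative_neg_dec_right by blast
          have "w s \<le> 0" if "t < s" "s < t + \<epsilon>" for s
            using \<epsilon>(2)[of "s - t"] kw[of s] kt that t t0 by auto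
          then show ?thesis
            using \<epsilon>(1) by (auto simp: eventually_at_right_field intro!: exI[of _ "t + \<epsilon>"])
        qed
      qed (use s1 in simp)
      then show ?thesis by (simp add: w_def)
    qed
    have "(infdist (z s1) K)\<^sup>2 \<le> 0"
    proof (rule field_le_epsilon)
      fix \<epsilon> :: real assume "\<epsilon> > 0"
      then show "(infdist (z s1) K)\<^sup>2 \<le> 0 + \<epsilon>"
        using small[of "\<epsilon> / exp ((2 * L + 1) * (s1 - t0))"] by simp
    qed
    then show ?thesis
      using in_closed_iff_infdist_zero[OF K] t0 by force
  qed
  then show "\<forall>\<^sub>F s in at_right t0. z s \<in> K"
    using e by (auto simp: eventually_at_right_field intro!: exI[of _ "t0 + e"])
qed

text \<open>The velocity \<open>v\<close> itself may be tangent to the boundary of \<open>K\<close> and point out of \<open>K\<close>; only its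
  perturbations by \<open>w\<close> are required to point into \<open>K\<close>.\<close>

lemma nearest_point_normal:
  fixes p v w y :: "'a::real_inner"
  assumes near: "\<And>k. k \<in> K \<Longrightarrow> dist y p \<le> dist y k"
    and dir: "\<And>\<epsilon>. \<epsilon> > 0 \<Longrightarrow> \<forall>\<^sub>F t in at_right 0. p + t *\<^sub>R (v + \<epsilon> *\<^sub>R w) \<in> K"
  shows "(y - p) \<bullet> v \<le> 0"
proof -
  have expand: "(a - t *\<^sub>R b) \<bullet> (a - t *\<^sub>R b) = a \<bullet> a + t * (t * (b \<bullet> b) - 2 * (a \<bullet> b))"
    for a b :: 'a and t
    by (simp add: inner_commute[of b a] algebra_simps)
  have *: "(y - p) \<bullet> (v + \<epsilon> *\<^sub>R w) \<le> 0" if "\<epsilon> > 0" for \<epsilon>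
  proof -
    let ?w = "v + \<epsilon> *\<^sub>R w"
    have "\<forall>\<^sub>F t in at_right (0::real). 2 * ((y - p) \<bullet> ?w) \<le> t * (?w \<bullet> ?w)"
      using dir[OF that] eventually_at_right_less[of "0::real"]
    proof eventually_elim
      case (elim t)
      have "norm (y - p) \<le> norm ((y - p) - t *\<^sub>R ?w)"
        using near[OF elim(1)] by (simp add: dist_norm algebra_simps)
      then have "(y - p) \<bullet> (y - p) \<le> ((y - p) - t *\<^sub>R ?w) \<bullet> ((y - p) - t *\<^sub>R ?w)"
        by (simp add: norm_le)
      also have "\<dots> = (y - p) \<bullet> (y - p) + t * (t * (?w \<bullet> ?w) - 2 * ((y - p) \<bullet> ?w))"
        by (rule expand)
      finally show ?case using elim(2) by (simp add: zero_le_mult_iff)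
    qed
    moreover have "((\<lambda>t. t * (?w \<bullet> ?w)) \<longlongrightarrow> 0 * (?w \<bullet> ?w)) (at_right 0)"
      by (intro tendsto_intros)
    ultimately have "2 * ((y - p) \<bullet> ?w) \<le> 0 * (?w \<bullet> ?w)"
      by (intro tendsto_lowerbound[where F = "at_right (0::real)"]) auto
    then show ?thesis by simp
  qed
  have "((\<lambda>\<epsilon>. (y - p) \<bullet> (v + \<epsilon> *\<^sub>R w)) \<longlongrightarrow> (y - p) \<bullet> (v + 0 *\<^sub>R w)) (at_right (0::real))"
    by (intro tendsto_intros)
  moreover have "\<forall>\<^sub>F \<epsilon> in at_right (0::real). (y - p) \<bullet> (v + \<epsilon> *\<^sub>R w) \<le> 0"
    using eventually_at_right_less[of "0::real"] by eventually_elim (rule *)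
  ultimately show ?thesis
    using tendsto_upperbound[of _ _ "at_right (0::real)"] by force
qed

lemma eventually_increasing_along:
  fixes h :: "'a::real_normed_vector \<Rightarrow> real"
  assumes "(h has_derivative h') (at p)" "h' w > 0"
  shows "\<forall>\<^sub>F t in at_right 0. h (p + t *\<^sub>R w) > h p"
proof -
  have lin: "linear h'" using assms(1) by (rule has_derivative_linear)
  have "(h has_derivative h') (at (p + 0 *\<^sub>R w))" using assms(1) by simp
  moreover have "((\<lambda>t::real. p + t *\<^sub>R w) has_derivative (\<lambda>t. t *\<^sub>R w)) (at 0)"
    by (auto intro!: derivative_eq_intros)
  ultimately have "((\<lambda>t. h (p + t *\<^sub>R w)) has_derivative (\<lambda>t. h' (t *\<^sub>R w))) (at 0)"
    using diff_chain_at[of "\<lambda>t::real. p + t *\<^sub>R w" _ 0 h h'] by (simp add: o_def)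
  then have "((\<lambda>t. h (p + t *\<^sub>R w)) has_real_derivative h' w) (at 0)"
    by (simp add: has_field_derivative_def linear_scale[OF lin] mult.commute[of _ "h' w"])
  from DERIV_pos_inc_right[OF this assms(2)] show ?thesis
    by (auto simp: eventually_at_right_field)
qed

subsection \<open>Continuously differentiable maps\<close>

lemma linear_eq_gradient_inner:
  fixes l :: "real^'k \<Rightarrow> real"
  assumes "linear l"
  shows "l v = (\<chi> i. l (axis i 1)) \<bullet> v"
proof -
  have "l v = l (\<Sum>i\<in>UNIV. v $ i *\<^sub>R axis i 1)"
    by (simp add: basis_expansion flip: scalar_mult_eq_scaleR)
  also have "\<dots> = (\<Sum>i\<in>UNIV. v $ i *\<^sub>R l (axis i 1))"
    by (simp add: linear_sum[OF assms] linear_scale[OF assms])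
  finally show ?thesis by (simp add: inner_vec_def mult.commute)
qed

lemma gradient_inner:
  assumes "(g has_derivative g') (at y)"
  shows "gradient g y \<bullet> v = g' v"
  using linear_eq_gradient_inner[OF has_derivative_linear[OF assms], of v]
  by (simp add: gradient_def frechet_derivative_at[OF assms, symmetric])

lemma C1_has_derivative_gradient:
  fixes h :: "(real^'n) \<times> (real^'m) \<Rightarrow> real"
  assumes "C1 h"
  shows "(h has_derivative (\<lambda>v. (grad_x h p, grad_u h p) \<bullet> v)) (at p)"
proof -
  obtain h' where h': "(h has_derivative h') (at p)"
    using assms unfolding C1_def by blast
  have "((\<lambda>x. h (x, snd p)) has_derivative (\<lambda>v. h' (v, 0))) (at (fst p))"
    using diff_chain_at[OF has_derivative_Pair[OF has_derivative_ident has_derivative_const], of h h' "fst p" "snd p"] h'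
    by (simp add: o_def)
  then have x: "grad_x h p \<bullet> v = h' (v, 0)" for v
    unfolding grad_x_def by (rule gradient_inner)
  have "((\<lambda>u. h (fst p, u)) has_derivative (\<lambda>v. h' (0, v))) (at (snd p))"
    using diff_chain_at[OF has_derivative_Pair[OF has_derivative_const has_derivative_ident], of h h' "fst p" "snd p"] h'
    by (simp add: o_def)
  then have u: "grad_u h p \<bullet> v = h' (0, v)" for v
    unfolding grad_u_def by (rule gradient_inner)
  have "h' v = (grad_x h p, grad_u h p) \<bullet> v" for v
    using linear_add[OF has_derivative_linear[OF h'], of "(fst v, 0)" "(0, snd v)"]
    by (cases v) (simp add: x u)
  then have "h' = (\<lambda>v. (grad_x h p, grad_u h p) \<bullet> v)" by auto
  with h' show ?thesis by simp
qed

lemma C1_locally_lipschitz: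
  fixes g :: "'a::euclidean_space \<Rightarrow> 'b::euclidean_space"
  assumes "C1 g"
  shows "locally_lipschitz g"
proof -
  obtain g' :: "'a \<Rightarrow> 'a \<Rightarrow>\<^sub>L 'b"
    where g': "\<And>z. (g has_derivative blinfun_apply (g' z)) (at z)" "continuous_on UNIV g'"
    using assms unfolding C1_def by blast
  have "\<exists>L. L-lipschitz_on (ball z 1) g" for z
  proof -
    have "compact (g' ` cball z 1)"
      using continuous_on_subset[OF g'(2)] by (intro compact_continuous_image) auto
    then obtain L where L: "\<And>x. x \<in> cball z 1 \<Longrightarrow> norm (g' x) \<le> L"
      using compact_imp_bounded bounded_iff by (metis imageI)
    have "L-lipschitz_on (ball z 1) g"
    proof (rule bounded_derivative_imp_lipschitz)
      show "(g has_derivative blinfun_apply (g' x)) (at x within ball z 1)" for x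
        using g'(1) by (rule has_derivative_at_withinI)
      show "onorm (blinfun_apply (g' x)) \<le> L" if "x \<in> ball z 1" for x
        using L[of x] that by (simp add: norm_blinfun.rep_eq)
      show "0 \<le> L" using order_trans[OF norm_ge_zero L[of z]] by simp
    qed simp
    then show ?thesis by blast
  qed
  then show ?thesis
    unfolding locally_lipschitz_def by (metis zero_less_one)
qed

lemma locally_lipschitz_add:
  fixes g k :: "'a::metric_space \<Rightarrow> 'b::real_normed_vector"
  assumes "locally_lipschitz g" "locally_lipschitz k"
  shows "locally_lipschitz (\<lambda>z. g z + k z)"
  unfolding locally_lipschitz_def
proof
  fix z
  obtain e L e' L' where "e > 0" "L-lipschitz_on (ball z e) g" "e' > 0" "L'-lipschitz_on (ball z e') k"
    using assms unfolding locally_lipschitz_def by metis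
  then have "min e e' > 0" "(L + L')-lipschitz_on (ball z (min e e')) (\<lambda>z. g z + k z)"
    by (auto intro!: lipschitz_intros intro: lipschitz_on_subset subset_ball)
  then show "\<exists>e>0. \<exists>L. L-lipschitz_on (ball z e) (\<lambda>z. g z + k z)" by blast
qed

lemma locally_lipschitz_Pair:
  assumes "locally_lipschitz g" "locally_lipschitz k"
  shows "locally_lipschitz (\<lambda>z. (g z, k z))"
  unfolding locally_lipschitz_def
proof
  fix z
  obtain e L e' L' where "e > 0" "L-lipschitz_on (ball z e) g" "e' > 0" "L'-lipschitz_on (ball z e') k"
    using assms unfolding locally_lipschitz_def by metis
  then have "min e e' > 0" "(sqrt (L\<^sup>2 + L'\<^sup>2))-lipschitz_on (ball z (min e e')) (\<lambda>z. (g z, k z))"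
    by (auto intro!: lipschitz_on_Pair intro: lipschitz_on_subset subset_ball)
  then show "\<exists>e>0. \<exists>L. L-lipschitz_on (ball z e) (\<lambda>z. (g z, k z))" by blast
qed

subsection \<open>Barriers along the closed loop\<close>

lemma closed_loop_invariant:
  fixes f :: "(real^'n) \<times> (real^'m) \<Rightarrow> real^'n"
    and \<phi> q :: "(real^'n) \<times> (real^'m) \<Rightarrow> real^'m"
  assumes f: "C1 f" and \<phi>: "C1 \<phi>" and q: "locally_lipschitz q" and \<tau>: "\<tau> > 0"
    and K: "closed K" and safe: "(\<Inter>h\<in>H. safe_set h) \<subseteq> K"
    and dir: "\<And>p d. p \<in> K \<Longrightarrow> norm d \<le> \<delta> \<Longrightarrow>
      \<exists>w. \<forall>\<epsilon>>0. \<forall>\<^sub>F t in at_right 0. p + t *\<^sub>R ((f p, \<phi> p + q p + d) + \<epsilon> *\<^sub>R w) \<in> K"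
  shows "forward_invariant \<tau> (admissible_run f \<phi> q \<tau> \<delta> H) K"
  unfolding forward_invariant_def
proof (intro allI impI)
  fix x u and t :: real
  assume run: "admissible_run f \<phi> q \<tau> \<delta> H x u" and t: "0 \<le> t"
  obtain xhat where cl: "closed_loop_solution f \<phi> q \<tau> x u xhat"
    and dist: "\<And>t. t \<ge> 0 \<Longrightarrow> norm (disturbance \<phi> q \<tau> x u xhat t) \<le> \<delta>"
    using run unfolding admissible_run_def by blast
  have init: "(x s, u (s - \<tau>)) \<in> K" if "s \<in> {0..\<tau>}" for s
    using run safe that unfolding admissible_run_def by blast
  show "(x t, u (t - \<tau>)) \<in> K"
  proof (cases "t \<le> \<tau>")
    case False
    define z where "z s = (predicted_state \<tau> x s, u s)" for s
    define F where "F p = (f p, \<phi> p + q p)" for p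
    define d where "d s = (0 :: real^'n, disturbance \<phi> q \<tau> x u xhat s)" for s
    have "z (t - \<tau>) \<in> K"
    proof (rule strong_invariance[where F = F and d = d])
      show "locally_lipschitz F"
        unfolding F_def
        by (intro locally_lipschitz_Pair locally_lipschitz_add C1_locally_lipschitz f \<phi> q)
      show "z 0 \<in> K" using init[of \<tau>] \<tau> by (simp add: z_def predicted_state_def)
      show "(z has_vector_derivative F (z s) + d s) (at s within {0..})" if s: "s \<ge> 0" for s
      proof -
        have shift: "(\<lambda>s. s + \<tau>) ` {0..} = {\<tau>..}"
          by (auto simp: image_iff intro!: bexI[of _ "_ - \<tau>"])
        have "\<forall>t\<in>{\<tau>..}. (x has_vector_derivative f (x t, u (t - \<tau>))) (at t within {\<tau>..})"
          using cl unfolding closed_loop_solution_def plant_solution_def by blast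
        from bspec[OF this, of "s + \<tau>"]
        have "(x has_vector_derivative f (x (s + \<tau>), u s)) (at (s + \<tau>) within (\<lambda>s. s + \<tau>) ` {0..})"
          using s unfolding shift by simp
        moreover have "((\<lambda>s. s + \<tau>) has_vector_derivative 1) (at s within {0..})"
          by (auto intro!: derivative_eq_intros)
        ultimately have "((\<lambda>s. x (s + \<tau>)) has_vector_derivative f (x (s + \<tau>), u s)) (at s within {0..})"
          using vector_diff_chain_within[of "\<lambda>s. s + \<tau>" 1 s "{0..}" x] by (simp add: o_def)
        moreover have "(u has_vector_derivative (\<phi> (xhat s, u s) + q (xhat s, u s))) (at s within {0..})"
          using cl s unfolding closed_loop_solution_def by simp
        ultimately show ?thesis
          unfolding z_def F_def d_def disturbance_def predicted_state_def
          by (auto intro!: derivative_eq_intros has_vector_derivative_Pair)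
      qed
      fix y p and s :: real
      assume p: "p \<in> K" and near: "\<And>k. k \<in> K \<Longrightarrow> dist y p \<le> dist y k" and s: "s \<ge> 0"
      obtain w where w: "\<And>\<epsilon>. \<epsilon> > 0 \<Longrightarrow> \<forall>\<^sub>F t in at_right 0. p + t *\<^sub>R ((F p + d s) + \<epsilon> *\<^sub>R w) \<in> K"
        using dir[OF p dist[OF s]] unfolding F_def d_def add_Pair add_0_right by blast
      from nearest_point_normal[OF near this] show "(y - p) \<bullet> (F p + d s) \<le> 0" .
    qed (use K False in auto)
    then show ?thesis by (simp add: z_def predicted_state_def)
  qed (use init t in auto)
qed

definition relaxed_set ::
  "(real \<Rightarrow> real) \<Rightarrow> (real \<Rightarrow> real) \<Rightarrow> real \<Rightarrow> ((real^'n) \<times> (real^'m) \<Rightarrow> real) \<Rightarrow>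
   ((real^'n) \<times> (real^'m)) set" where
  "relaxed_set \<alpha> \<sigma> c h = {z. \<alpha> (h z) + c / (4 * \<sigma> (h z)) \<ge> 0}"

context
  fixes D :: "real set" and \<alpha> \<mu> \<sigma> :: "real \<Rightarrow> real" and \<delta> :: real
    and h :: "(real^'n) \<times> (real^'m) \<Rightarrow> real"
  assumes data: "barrier_data D \<alpha> \<mu> \<sigma> \<delta> h"
begin

lemma barrier_sigma_pos: "\<sigma> s > 0"
  using data by (simp add: barrier_data_def)

lemma barrier_domain_zero: "0 \<in> D"
proof -
  obtain a b :: ereal where "0 < a" "0 < b" "D = {s. - b < ereal s \<and> ereal s < a}"
    using data unfolding barrier_data_def ext_class_K_def by blast
  moreover from this have "- b < 0" by (cases b) auto
  ultimately show ?thesis by (simp flip: zero_ereal_def)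
qed

lemma barrier_in_domain: "h z \<in> D"
  using data unfolding barrier_data_def by blast

lemma barrier_alpha_strict_mono: "strict_mono_on D \<alpha>"
  using data by (simp add: barrier_data_def ext_class_K_def)

lemma barrier_alpha_le_iff: "s \<in> D \<Longrightarrow> s' \<in> D \<Longrightarrow> \<alpha> s \<le> \<alpha> s' \<longleftrightarrow> s \<le> s'"
  using barrier_alpha_strict_mono by (rule strict_mono_on_less_eq)

lemma barrier_alpha_nonneg_iff: "0 \<le> \<alpha> (h z) \<longleftrightarrow> 0 \<le> h z"
  and barrier_alpha_nonpos_iff: "\<alpha> (h z) \<le> 0 \<longleftrightarrow> h z \<le> 0"
  using barrier_alpha_le_iff[OF barrier_domain_zero barrier_in_domain, of z] barrier_alpha_le_iff[OF barrier_in_domain barrier_domain_zero, of z] data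
  by (simp_all add: barrier_data_def ext_class_K_def)

lemma safe_set_eq_relaxed: "safe_set h = relaxed_set \<alpha> \<sigma> 0 h"
  by (simp add: safe_set_def relaxed_set_def barrier_alpha_nonneg_iff)

lemma inflated_set_eq_relaxed:
  "inflated_set D \<alpha> \<mu> \<sigma> \<delta> h = relaxed_set \<alpha> \<sigma> ((\<mu> 0 - \<delta>)\<^sup>2) h"
proof -
  have "inv_into D \<alpha> y \<le> h z \<longleftrightarrow> y \<le> \<alpha> (h z)" if "y \<in> \<alpha> ` D" for y z
    using barrier_alpha_le_iff[OF inv_into_into[OF that] barrier_in_domain, of z] f_inv_into_f[OF that] by simp
  moreover have "- ((\<mu> 0 - \<delta>)\<^sup>2 / (4 * \<sigma> (h z))) \<in> \<alpha> ` D" for z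
    using data unfolding barrier_data_def by blast
  ultimately show ?thesis
    by (auto simp: inflated_set_def inflated_barrier_def relaxed_set_def algebra_simps)
qed

lemma relaxed_set_mono: "c \<le> c' \<Longrightarrow> relaxed_set \<alpha> \<sigma> c h \<subseteq> relaxed_set \<alpha> \<sigma> c' h"
proof
  fix z assume "c \<le> c'" and z: "z \<in> relaxed_set \<alpha> \<sigma> c h"
  then have "c / (4 * \<sigma> (h z)) \<le> c' / (4 * \<sigma> (h z))"
    using barrier_sigma_pos[of "h z"] by (intro divide_right_mono) auto
  with z show "z \<in> relaxed_set \<alpha> \<sigma> c' h" by (simp add: relaxed_set_def)
qed

lemma continuous_relaxed: "continuous_on UNIV (\<lambda>z. \<alpha> (h z) + c / (4 * \<sigma> (h z)))"
proof -
  have C1_cont: "continuous_on UNIV g" if "C1 g" for g :: "'a::real_normed_vector \<Rightarrow> 'b::real_normed_vector"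
    using that unfolding C1_def
    by (meson continuous_at_imp_continuous_on has_derivative_continuous)
  have h: "continuous_on UNIV h" and \<sigma>: "continuous_on UNIV \<sigma>" and \<alpha>: "continuous_on D \<alpha>"
    using data by (simp_all add: barrier_data_def ext_class_K_def C1_cont)
  show ?thesis
    using barrier_sigma_pos
    by (intro continuous_intros continuous_on_compose2[OF \<alpha> h] continuous_on_compose2[OF \<sigma> h])
      (auto simp: barrier_in_domain less_imp_neq[symmetric])
qed

lemma closed_relaxed_set: "closed (relaxed_set \<alpha> \<sigma> c h)"
  unfolding relaxed_set_def by (intro closed_Collect_le continuous_relaxed continuous_on_const)

lemma relaxed_set_direction:
  assumes c: "0 \<le> c" and p: "p \<in> relaxed_set \<alpha> \<sigma> c h"
    and w: "\<alpha> (h p) + c / (4 * \<sigma> (h p)) = 0 \<Longrightarrow> 0 < (grad_x h p, grad_u h p) \<bullet> w"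
  shows "\<forall>\<^sub>F t in at_right 0. p + t *\<^sub>R w \<in> relaxed_set \<alpha> \<sigma> c h"
proof (cases "\<alpha> (h p) + c / (4 * \<sigma> (h p)) = 0")
  case True
  have "antimono \<sigma>" "C1 h" using data by (simp_all add: barrier_data_def)
  from eventually_increasing_along[OF C1_has_derivative_gradient[OF this(2)] w[OF True]]
  show ?thesis
  proof eventually_elim
    case (elim t)
    then have "\<alpha> (h p) \<le> \<alpha> (h (p + t *\<^sub>R w))" "\<sigma> (h (p + t *\<^sub>R w)) \<le> \<sigma> (h p)"
      using barrier_alpha_le_iff[OF barrier_in_domain barrier_in_domain] \<open>antimono \<sigma>\<close> by (auto simp: antimono_def)
    then have "\<alpha> (h p) + c / (4 * \<sigma> (h p)) \<le>
        \<alpha> (h (p + t *\<^sub>R w)) + c / (4 * \<sigma> (h (p + t *\<^sub>R w)))"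
      using c barrier_sigma_pos by (intro add_mono divide_left_mono) auto
    then show ?case using True by (simp add: relaxed_set_def)
  qed
next
  case False
  let ?g = "\<lambda>z. \<alpha> (h z) + c / (4 * \<sigma> (h z))"
  have "((\<lambda>t. p + t *\<^sub>R w) \<longlongrightarrow> p + 0 *\<^sub>R w) (at_right 0)" by (intro tendsto_intros)
  then have "((\<lambda>t. ?g (p + t *\<^sub>R w)) \<longlongrightarrow> ?g p) (at_right 0)"
    by (intro continuous_on_tendsto_compose[OF continuous_relaxed]) auto
  moreover have "0 < ?g p" using False p by (simp add: relaxed_set_def)
  ultimately have "\<forall>\<^sub>F t in at_right 0. 0 < ?g (p + t *\<^sub>R w)" by (rule order_tendstoD)
  then show ?thesis by eventually_elim (simp add: relaxed_set_def)
qed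

lemma active_nonpos:
  assumes "0 \<le> c" and "\<alpha> (h p) + c / (4 * \<sigma> (h p)) = 0"
  shows "h p \<le> 0"
proof -
  have "0 \<le> c / (4 * \<sigma> (h p))" using assms barrier_sigma_pos[of "h p"] by simp
  with assms have "\<alpha> (h p) \<le> 0" by linarith
  then show ?thesis by (simp add: barrier_alpha_nonpos_iff)
qed

lemma active_derivative_nonneg:
  assumes c: "(max 0 (\<delta> - \<mu> 0))\<^sup>2 \<le> c" and act: "\<alpha> (h p) + c / (4 * \<sigma> (h p)) = 0"
    and q: "barrier_b h p \<bullet> q p \<ge> barrier_a f \<phi> \<alpha> h p + barrier_r \<mu> \<sigma> h p"
    and d: "norm d \<le> \<delta>"
  shows "0 \<le> (grad_x h p, grad_u h p) \<bullet> (f p, \<phi> p + q p + d)"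
proof -
  define \<beta> s where "\<beta> = norm (barrier_b h p)" and "s = \<sigma> (h p)"
  have \<beta>: "0 \<le> \<beta>" and s: "0 < s" using barrier_sigma_pos by (simp_all add: \<beta>_def s_def)
  have "0 \<le> c" using c zero_le_power2 order_trans by blast
  from active_nonpos[OF this act] have "\<mu> 0 \<le> \<mu> (h p)"
    using data by (simp add: barrier_data_def antimono_def)
  then have \<mu>: "\<mu> 0 * \<beta> \<le> \<mu> (h p) * \<beta>" using \<beta> by (rule mult_right_mono)
  have "- (barrier_b h p \<bullet> d) \<le> \<beta> * \<delta>"
    using norm_cauchy_schwarz[of "barrier_b h p" "- d"] mult_left_mono[OF d \<beta>]
    by (simp add: \<beta>_def)
  then have *: "c / (4 * s) + (\<mu> 0 - \<delta>) * \<beta> + s * \<beta>\<^sup>2 \<le>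
      (grad_x h p, grad_u h p) \<bullet> (f p, \<phi> p + q p + d)"
    using q act \<mu> by (simp add: barrier_a_def barrier_r_def barrier_b_def \<beta>_def s_def
        inner_add_right algebra_simps)
  let ?m = "max 0 (\<delta> - \<mu> 0)"
  have "?m\<^sup>2 / (4 * s) - ?m * \<beta> + s * \<beta>\<^sup>2 = (?m - 2 * s * \<beta>)\<^sup>2 / (4 * s)"
    using s by (simp add: field_simps power2_eq_square)
  then have "0 \<le> ?m\<^sup>2 / (4 * s) - ?m * \<beta> + s * \<beta>\<^sup>2" using s by simp
  moreover have "?m\<^sup>2 / (4 * s) \<le> c / (4 * s)" using c s by (simp add: divide_right_mono)
  moreover have "(\<delta> - \<mu> 0) * \<beta> \<le> ?m * \<beta>" using \<beta> by (intro mult_right_mono) auto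
  ultimately show ?thesis using * by (simp add: algebra_simps)
qed

end

lemma common_ascent_direction:
  fixes g :: "'a::real_inner" and b b' :: "'b::real_inner"
  assumes b': "b' \<noteq> 0" and nz: "(g, b) \<noteq> 0"
    and not_opposite: "g = 0 \<Longrightarrow> norm b * norm b' + b \<bullet> b' \<noteq> 0"
  shows "\<exists>w. 0 < (g, b) \<bullet> w \<and> 0 < (0, b') \<bullet> w"
proof (cases "g = 0")
  case True
  let ?s = "norm b * norm b' + b \<bullet> b'"
  have "0 \<le> ?s" using norm_cauchy_schwarz[of b "- b'"] by simp
  then have s: "0 < ?s" using not_opposite[OF True] by simp
  have "b \<noteq> 0" using nz True by (simp add: zero_prod_def)
  then have "0 < norm b * ?s" "0 < norm b' * ?s" using b' s by simp_all
  moreover have "b \<bullet> (norm b' *\<^sub>R b + norm b *\<^sub>R b') = norm b * ?s"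
    "b' \<bullet> (norm b' *\<^sub>R b + norm b *\<^sub>R b') = norm b' * ?s"
    by (simp_all add: inner_add_right dot_square_norm power2_eq_square inner_commute[of b'] algebra_simps)
  ultimately show ?thesis
    by (intro exI[of _ "(0, norm b' *\<^sub>R b + norm b *\<^sub>R b')"]) simp
next
  case False
  let ?M = "(\<bar>b \<bullet> b'\<bar> + 1) / (g \<bullet> g)"
  have "0 < ?M * (g \<bullet> g) + b \<bullet> b'" using False by simp
  then show ?thesis using b' by (intro exI[of _ "(?M *\<^sub>R g, b')"]) simp
qed

lemma single_barrier_invariant:
  fixes f :: "(real^'n) \<times> (real^'m) \<Rightarrow> real^'n"
    and \<phi> q :: "(real^'n) \<times> (real^'m) \<Rightarrow> real^'m"
  assumes f: "C1 f" and \<phi>: "C1 \<phi>" and q: "locally_lipschitz q" and \<tau>: "\<tau> > 0"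
    and data: "barrier_data D \<alpha> \<mu> \<sigma> \<delta> h" and reg: "regular_barrier h"
    and c: "(max 0 (\<delta> - \<mu> 0))\<^sup>2 \<le> c"
    and qb: "\<And>z. z \<in> relaxed_set \<alpha> \<sigma> c h \<Longrightarrow>
           barrier_b h z \<bullet> q z \<ge> barrier_a f \<phi> \<alpha> h z + barrier_r \<mu> \<sigma> h z"
  shows "forward_invariant \<tau> (admissible_run f \<phi> q \<tau> \<delta> {h}) (relaxed_set \<alpha> \<sigma> c h)"
proof (rule closed_loop_invariant[OF f \<phi> q \<tau>])
  have c0: "0 \<le> c" using c zero_le_power2 order_trans by blast
  show "closed (relaxed_set \<alpha> \<sigma> c h)" using data by (rule closed_relaxed_set)
  show "(\<Inter>h\<in>{h}. safe_set h) \<subseteq> relaxed_set \<alpha> \<sigma> c h"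
    using safe_set_eq_relaxed[OF data] relaxed_set_mono[OF data c0] by simp
  fix p and d :: "real^'m" assume p: "p \<in> relaxed_set \<alpha> \<sigma> c h" and d: "norm d \<le> \<delta>"
  let ?G = "(grad_x h p, grad_u h p)" and ?v = "(f p, \<phi> p + q p + d)"
  have "0 < ?G \<bullet> (?v + \<epsilon> *\<^sub>R ?G)"
    if act: "\<alpha> (h p) + c / (4 * \<sigma> (h p)) = 0" and "\<epsilon> > 0" for \<epsilon>
  proof -
    have "?G \<noteq> 0" using reg active_nonpos[OF data c0 act] unfolding regular_barrier_def by blast
    then have "0 < \<epsilon> * (?G \<bullet> ?G)" using \<open>\<epsilon> > 0\<close> inner_gt_zero_iff by (metis mult_pos_pos)
    then show ?thesis
      unfolding inner_add_right inner_scaleR_right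
      using active_derivative_nonneg[where q = q, OF data c act qb[OF p] d] by linarith
  qed
  then show "\<exists>w. \<forall>\<epsilon>>0. \<forall>\<^sub>F t in at_right 0. p + t *\<^sub>R (?v + \<epsilon> *\<^sub>R w) \<in> relaxed_set \<alpha> \<sigma> c h"
    by (intro exI[of _ ?G] allI impI relaxed_set_direction[OF data c0 p]) blast
qed

lemma two_barrier_invariant:
  fixes f :: "(real^'n) \<times> (real^'m) \<Rightarrow> real^'n"
    and \<phi> q :: "(real^'n) \<times> (real^'m) \<Rightarrow> real^'m"
  assumes f: "C1 f" and \<phi>: "C1 \<phi>" and q: "locally_lipschitz q" and \<tau>: "\<tau> > 0"
    and e: "barrier_data D \<alpha> \<mu> \<sigma> \<delta> h" and u: "barrier_data D' \<alpha>' \<mu>' \<sigma>' \<delta> h'"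
    and reg: "regular_barrier h" "regular_barrier h'"
    and h': "\<And>z. grad_x h' z = 0"
    and c: "(max 0 (\<delta> - \<mu> 0))\<^sup>2 \<le> c" and c': "(max 0 (\<delta> - \<mu>' 0))\<^sup>2 \<le> c'"
    and compat: "\<And>z. norm (barrier_b h z) * norm (barrier_b h' z) + barrier_b h z \<bullet> barrier_b h' z = 0 \<Longrightarrow>
           (barrier_a f \<phi> \<alpha> h z + barrier_r \<mu> \<sigma> h z) * norm (barrier_b h' z) +
           (barrier_a f \<phi> \<alpha>' h' z + barrier_r \<mu>' \<sigma>' h' z) * norm (barrier_b h z) \<le> 0"
    and qb: "\<And>z. z \<in> relaxed_set \<alpha> \<sigma> c h \<inter> relaxed_set \<alpha>' \<sigma>' c' h' \<Longrightarrow>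
           barrier_b h z \<bullet> q z \<ge> barrier_a f \<phi> \<alpha> h z + barrier_r \<mu> \<sigma> h z \<and>
           barrier_b h' z \<bullet> q z \<ge> barrier_a f \<phi> \<alpha>' h' z + barrier_r \<mu>' \<sigma>' h' z"
  shows "forward_invariant \<tau> (admissible_run f \<phi> q \<tau> \<delta> {h, h'})
           (relaxed_set \<alpha> \<sigma> c h \<inter> relaxed_set \<alpha>' \<sigma>' c' h')"
proof (rule closed_loop_invariant[OF f \<phi> q \<tau>])
  let ?K = "relaxed_set \<alpha> \<sigma> c h \<inter> relaxed_set \<alpha>' \<sigma>' c' h'"
  have c0: "0 \<le> c" "0 \<le> c'" using c c' zero_le_power2 order_trans by blast+
  show "closed ?K" using e u by (intro closed_Int closed_relaxed_set)
  show "(\<Inter>h\<in>{h, h'}. safe_set h) \<subseteq> ?K"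
    using safe_set_eq_relaxed[OF e] relaxed_set_mono[OF e c0(1)]
      safe_set_eq_relaxed[OF u] relaxed_set_mono[OF u c0(2)] by auto
  fix p and d :: "real^'m" assume p: "p \<in> ?K" and d: "norm d \<le> \<delta>"
  let ?G = "(grad_x h p, grad_u h p)" and ?G' = "(grad_x h' p, grad_u h' p)"
    and ?v = "(f p, \<phi> p + q p + d)"
  let ?act = "\<alpha> (h p) + c / (4 * \<sigma> (h p)) = 0" and ?act' = "\<alpha>' (h' p) + c' / (4 * \<sigma>' (h' p)) = 0"
  have G: "?G \<noteq> 0" if ?act
    using reg active_nonpos[OF e c0(1) that] unfolding regular_barrier_def by blast
  have G': "?G' \<noteq> 0" if ?act'
    using reg active_nonpos[OF u c0(2) that] unfolding regular_barrier_def by blast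
  have "\<exists>w. (?act \<longrightarrow> 0 < ?G \<bullet> w) \<and> (?act' \<longrightarrow> 0 < ?G' \<bullet> w)"
  proof (cases "?act \<and> ?act'")
    case True
    let ?b = "norm (barrier_b h p)" and ?b' = "norm (barrier_b h' p)"
    have b': "barrier_b h' p \<noteq> 0"
      using G' True by (simp add: h' barrier_b_def zero_prod_def)
    have "?b * ?b' + barrier_b h p \<bullet> barrier_b h' p \<noteq> 0" if g: "grad_x h p = 0"
    proof
      assume opp: "?b * ?b' + barrier_b h p \<bullet> barrier_b h' p = 0"
      have b: "barrier_b h p \<noteq> 0"
        using G True g by (simp add: barrier_b_def zero_prod_def)
      have "?b' *\<^sub>R barrier_b h p + ?b *\<^sub>R barrier_b h' p = 0"
      proof -
        have "barrier_b h p \<bullet> (- barrier_b h' p) = ?b * norm (- barrier_b h' p)"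
          using opp by simp
        then show ?thesis
          unfolding norm_cauchy_schwarz_eq by (simp add: eq_neg_iff_add_eq_0 add.commute neg_eq_iff_add_eq_0)
      qed
      then have "(?b' *\<^sub>R barrier_b h p + ?b *\<^sub>R barrier_b h' p) \<bullet> \<phi> p = 0" by simp
      then have cancel: "?b' * (barrier_b h p \<bullet> \<phi> p) + ?b * (barrier_b h' p \<bullet> \<phi> p) = 0"
        by (simp add: inner_add_left)
      have pos: "0 < barrier_r \<mu> \<sigma> h p" "0 < barrier_r \<mu>' \<sigma>' h' p"
        using b b' e u by (simp_all add: barrier_r_def barrier_data_def add_pos_pos)
      have "0 \<le> - \<alpha> (h p)" "0 \<le> - \<alpha>' (h' p)"
        using active_nonpos[OF e c0(1), of p] active_nonpos[OF u c0(2), of p] True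
          barrier_alpha_nonpos_iff[OF e] barrier_alpha_nonpos_iff[OF u] by simp_all
      with pos b b' have "0 < (barrier_r \<mu> \<sigma> h p - \<alpha> (h p)) * ?b' + (barrier_r \<mu>' \<sigma>' h' p - \<alpha>' (h' p)) * ?b"
        by (intro add_pos_pos mult_pos_pos) auto
      with compat[OF opp] cancel show False
        by (simp add: barrier_a_def g h' barrier_b_def algebra_simps)
    qed
    from common_ascent_direction[OF b' _ this] G True show ?thesis
      by (simp add: barrier_b_def h')
  next
    case False
    then show ?thesis
      using G G' inner_gt_zero_iff by metis
  qed
  then obtain w where w: "?act \<Longrightarrow> 0 < ?G \<bullet> w" "?act' \<Longrightarrow> 0 < ?G' \<bullet> w" by blast
  have "0 < ?G \<bullet> (?v + \<epsilon> *\<^sub>R w)" if act: ?act and "\<epsilon> > 0" for \<epsilon>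
    unfolding inner_add_right inner_scaleR_right
    using active_derivative_nonneg[where q = q, OF e c act _ d] qb[OF p] w(1)[OF act] \<open>\<epsilon> > 0\<close>
    by (intro add_nonneg_pos mult_pos_pos) auto
  moreover have "0 < ?G' \<bullet> (?v + \<epsilon> *\<^sub>R w)" if act: ?act' and "\<epsilon> > 0" for \<epsilon>
    unfolding inner_add_right inner_scaleR_right
    using active_derivative_nonneg[where q = q, OF u c' act _ d] qb[OF p] w(2)[OF act] \<open>\<epsilon> > 0\<close>
    by (intro add_nonneg_pos mult_pos_pos) auto
  ultimately have "\<forall>\<^sub>F t in at_right 0. p + t *\<^sub>R (?v + \<epsilon> *\<^sub>R w) \<in> ?K" if "\<epsilon> > 0" for \<epsilon>
    unfolding Int_iff using that p
    by (intro eventually_conj relaxed_set_direction[OF e c0(1)] relaxed_set_direction[OF u c0(2)]) auto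
  then show "\<exists>w. \<forall>\<epsilon>>0. \<forall>\<^sub>F t in at_right 0. p + t *\<^sub>R (?v + \<epsilon> *\<^sub>R w) \<in> ?K" by blast
qed

lemma grad_x_eq_0:
  assumes "\<And>x u. h (x, u) = g u"
  shows "grad_x h z = 0"
proof -
  have "((\<lambda>x. h (x, snd z)) has_derivative (\<lambda>_. 0)) (at (fst z))"
    by (simp add: assms)
  from gradient_inner[OF this, of "grad_x h z"] show ?thesis
    by (simp add: grad_x_def)
qed

theorem theorem2:
  fixes f :: "(real^'n) \<times> (real^'m) \<Rightarrow> real^'n"
    and \<phi> q :: "(real^'n) \<times> (real^'m) \<Rightarrow> real^'m"
    and \<tau> \<delta> :: real
  assumes "C1 f" and "C1 \<phi>" and "locally_lipschitz q"
    and "\<tau> > 0" and "\<delta> \<ge> 0"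
    and "plant_well_posed f \<tau>"
  shows
    "(\<forall>(h :: (real^'n) \<times> (real^'m) \<Rightarrow> real) D \<alpha> \<mu> \<sigma>.
        barrier_data D \<alpha> \<mu> \<sigma> \<delta> h \<longrightarrow>
        regular_barrier h \<longrightarrow>
        (\<forall>z. barrier_b h z = 0 \<longrightarrow> barrier_a f \<phi> \<alpha> h z \<le> 0) \<longrightarrow>
        (\<forall>z \<in> inflated_set D \<alpha> \<mu> \<sigma> \<delta> h.
           barrier_b h z \<bullet> q z \<ge> barrier_a f \<phi> \<alpha> h z + barrier_r \<mu> \<sigma> h z) \<longrightarrow>
        forward_invariant \<tau> (admissible_run f \<phi> q \<tau> \<delta> {h}) (inflated_set D \<alpha> \<mu> \<sigma> \<delta> h) \<and>
        (\<delta> \<le> \<mu> 0 \<longrightarrow>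
          forward_invariant \<tau> (admissible_run f \<phi> q \<tau> \<delta> {h}) (safe_set h)))
     \<and>
     (\<forall>(h\<^sub>x :: real^'n \<Rightarrow> real) D\<^sub>x \<alpha>\<^sub>x
       (h\<^sub>e :: (real^'n) \<times> (real^'m) \<Rightarrow> real) D\<^sub>e \<alpha>\<^sub>e \<mu>\<^sub>e \<sigma>\<^sub>e
       (h\<^sub>u :: (real^'n) \<times> (real^'m) \<Rightarrow> real) D\<^sub>u \<alpha>\<^sub>u \<mu>\<^sub>u \<sigma>\<^sub>u.
        C1 h\<^sub>x \<longrightarrow> ext_class_K D\<^sub>x \<alpha>\<^sub>x \<longrightarrow> (\<forall>x. h\<^sub>x x \<in> D\<^sub>x) \<longrightarrow>
        h\<^sub>e = extended_barrier f \<alpha>\<^sub>x h\<^sub>x \<longrightarrow>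
        (\<exists>g. \<forall>x u. h\<^sub>u (x, u) = g u) \<longrightarrow>
        barrier_data D\<^sub>e \<alpha>\<^sub>e \<mu>\<^sub>e \<sigma>\<^sub>e \<delta> h\<^sub>e \<longrightarrow>
        barrier_data D\<^sub>u \<alpha>\<^sub>u \<mu>\<^sub>u \<sigma>\<^sub>u \<delta> h\<^sub>u \<longrightarrow>
        regular_barrier h\<^sub>e \<longrightarrow> regular_barrier h\<^sub>u \<longrightarrow>
        (\<forall>z. barrier_b h\<^sub>e z = 0 \<longrightarrow> barrier_a f \<phi> \<alpha>\<^sub>e h\<^sub>e z \<le> 0) \<longrightarrow>
        (\<forall>z. barrier_b h\<^sub>u z = 0 \<longrightarrow> barrier_a f \<phi> \<alpha>\<^sub>u h\<^sub>u z \<le> 0) \<longrightarrow>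
        (\<forall>z. norm (barrier_b h\<^sub>e z) * norm (barrier_b h\<^sub>u z) + barrier_b h\<^sub>e z \<bullet> barrier_b h\<^sub>u z = 0 \<longrightarrow>
           (barrier_a f \<phi> \<alpha>\<^sub>e h\<^sub>e z + barrier_r \<mu>\<^sub>e \<sigma>\<^sub>e h\<^sub>e z) * norm (barrier_b h\<^sub>u z) +
           (barrier_a f \<phi> \<alpha>\<^sub>u h\<^sub>u z + barrier_r \<mu>\<^sub>u \<sigma>\<^sub>u h\<^sub>u z) * norm (barrier_b h\<^sub>e z) \<le> 0) \<longrightarrow>
        (\<forall>z \<in> inflated_set D\<^sub>e \<alpha>\<^sub>e \<mu>\<^sub>e \<sigma>\<^sub>e \<delta> h\<^sub>e \<inter> inflated_set D\<^sub>u \<alpha>\<^sub>u \<mu>\<^sub>u \<sigma>\<^sub>u \<delta> h\<^sub>u.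
           barrier_b h\<^sub>e z \<bullet> q z \<ge> barrier_a f \<phi> \<alpha>\<^sub>e h\<^sub>e z + barrier_r \<mu>\<^sub>e \<sigma>\<^sub>e h\<^sub>e z \<and>
           barrier_b h\<^sub>u z \<bullet> q z \<ge> barrier_a f \<phi> \<alpha>\<^sub>u h\<^sub>u z + barrier_r \<mu>\<^sub>u \<sigma>\<^sub>u h\<^sub>u z) \<longrightarrow>
        forward_invariant \<tau> (admissible_run f \<phi> q \<tau> \<delta> {h\<^sub>e, h\<^sub>u})
          (inflated_set D\<^sub>e \<alpha>\<^sub>e \<mu>\<^sub>e \<sigma>\<^sub>e \<delta> h\<^sub>e \<inter> inflated_set D\<^sub>u \<alpha>\<^sub>u \<mu>\<^sub>u \<sigma>\<^sub>u \<delta> h\<^sub>u) \<and>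
        (\<delta> \<le> min (\<mu>\<^sub>e 0) (\<mu>\<^sub>u 0) \<longrightarrow>
          forward_invariant \<tau> (admissible_run f \<phi> q \<tau> \<delta> {h\<^sub>e, h\<^sub>u}) (safe_set h\<^sub>e \<inter> safe_set h\<^sub>u)))"
proof -
  have infl: "(max 0 (\<delta> - m))\<^sup>2 \<le> (m - \<delta>)\<^sup>2" for m :: real
    by (auto simp: max_def power2_commute)
  have safe: "(max 0 (\<delta> - m))\<^sup>2 \<le> 0" if "\<delta> \<le> m" for m :: real
    using that by simp
  note hyps = assms(1-4)
  show ?thesis
  proof (intro conjI allI impI)
    fix h :: "(real^'n) \<times> (real^'m) \<Rightarrow> real" and D \<alpha> \<mu> \<sigma>
    assume data: "barrier_data D \<alpha> \<mu> \<sigma> \<delta> h" and reg: "regular_barrier h"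
      and qb: "\<forall>z \<in> inflated_set D \<alpha> \<mu> \<sigma> \<delta> h.
           barrier_b h z \<bullet> q z \<ge> barrier_a f \<phi> \<alpha> h z + barrier_r \<mu> \<sigma> h z"
    note eqs = inflated_set_eq_relaxed[OF data] safe_set_eq_relaxed[OF data]
    show "forward_invariant \<tau> (admissible_run f \<phi> q \<tau> \<delta> {h}) (inflated_set D \<alpha> \<mu> \<sigma> \<delta> h)"
      using qb unfolding eqs by (intro single_barrier_invariant[OF hyps data reg infl]) blast
    show "forward_invariant \<tau> (admissible_run f \<phi> q \<tau> \<delta> {h}) (safe_set h)" if "\<delta> \<le> \<mu> 0"
      using qb relaxed_set_mono[OF data zero_le_power2] unfolding eqs
      by (intro single_barrier_invariant[OF hyps data reg safe[OF that]]) blast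
  next
    fix h\<^sub>x :: "real^'n \<Rightarrow> real" and D\<^sub>x \<alpha>\<^sub>x
      and h\<^sub>e :: "(real^'n) \<times> (real^'m) \<Rightarrow> real" and D\<^sub>e \<alpha>\<^sub>e \<mu>\<^sub>e \<sigma>\<^sub>e
      and h\<^sub>u :: "(real^'n) \<times> (real^'m) \<Rightarrow> real" and D\<^sub>u \<alpha>\<^sub>u \<mu>\<^sub>u \<sigma>\<^sub>u
    assume "\<exists>g. \<forall>x u. h\<^sub>u (x, u) = g u"
      and e: "barrier_data D\<^sub>e \<alpha>\<^sub>e \<mu>\<^sub>e \<sigma>\<^sub>e \<delta> h\<^sub>e" and u: "barrier_data D\<^sub>u \<alpha>\<^sub>u \<mu>\<^sub>u \<sigma>\<^sub>u \<delta> h\<^sub>u"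
      and reg: "regular_barrier h\<^sub>e" "regular_barrier h\<^sub>u"
      and compat: "\<forall>z. norm (barrier_b h\<^sub>e z) * norm (barrier_b h\<^sub>u z) + barrier_b h\<^sub>e z \<bullet> barrier_b h\<^sub>u z = 0 \<longrightarrow>
           (barrier_a f \<phi> \<alpha>\<^sub>e h\<^sub>e z + barrier_r \<mu>\<^sub>e \<sigma>\<^sub>e h\<^sub>e z) * norm (barrier_b h\<^sub>u z) +
           (barrier_a f \<phi> \<alpha>\<^sub>u h\<^sub>u z + barrier_r \<mu>\<^sub>u \<sigma>\<^sub>u h\<^sub>u z) * norm (barrier_b h\<^sub>e z) \<le> 0"
      and qb: "\<forall>z \<in> inflated_set D\<^sub>e \<alpha>\<^sub>e \<mu>\<^sub>e \<sigma>\<^sub>e \<delta> h\<^sub>e \<inter> inflated_set D\<^sub>u \<alpha>\<^sub>u \<mu>\<^sub>u \<sigma>\<^sub>u \<delta> h\<^sub>u.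
           barrier_b h\<^sub>e z \<bullet> q z \<ge> barrier_a f \<phi> \<alpha>\<^sub>e h\<^sub>e z + barrier_r \<mu>\<^sub>e \<sigma>\<^sub>e h\<^sub>e z \<and>
           barrier_b h\<^sub>u z \<bullet> q z \<ge> barrier_a f \<phi> \<alpha>\<^sub>u h\<^sub>u z + barrier_r \<mu>\<^sub>u \<sigma>\<^sub>u h\<^sub>u z"
    have gx: "grad_x h\<^sub>u z = 0" for z
      using \<open>\<exists>g. \<forall>x u. h\<^sub>u (x, u) = g u\<close> grad_x_eq_0 by metis
    note eqs = inflated_set_eq_relaxed[OF e] safe_set_eq_relaxed[OF e]
      inflated_set_eq_relaxed[OF u] safe_set_eq_relaxed[OF u]
    note inv = two_barrier_invariant[OF hyps e u reg gx _ _ compat[rule_format]]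
    show "forward_invariant \<tau> (admissible_run f \<phi> q \<tau> \<delta> {h\<^sub>e, h\<^sub>u})
          (inflated_set D\<^sub>e \<alpha>\<^sub>e \<mu>\<^sub>e \<sigma>\<^sub>e \<delta> h\<^sub>e \<inter> inflated_set D\<^sub>u \<alpha>\<^sub>u \<mu>\<^sub>u \<sigma>\<^sub>u \<delta> h\<^sub>u)"
      unfolding eqs by (rule inv[OF infl infl]) (use qb in \<open>simp_all add: eqs\<close>)
    show "forward_invariant \<tau> (admissible_run f \<phi> q \<tau> \<delta> {h\<^sub>e, h\<^sub>u}) (safe_set h\<^sub>e \<inter> safe_set h\<^sub>u)"
      if "\<delta> \<le> min (\<mu>\<^sub>e 0) (\<mu>\<^sub>u 0)"
    proof -
      have "\<delta> \<le> \<mu>\<^sub>e 0" "\<delta> \<le> \<mu>\<^sub>u 0" using that by simp_all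
      from inv[OF safe[OF this(1)] safe[OF this(2)]] show ?thesis
        using qb relaxed_set_mono[OF e zero_le_power2] relaxed_set_mono[OF u zero_le_power2]
        unfolding eqs by blast
    qed
  qed
qed

end
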